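(* Let $\Gamma$ be a discrete group of isometries of a symmetric space $(X,d)$. Let $p,q\in X$ be points whose stabiliser subgroups in $\Gamma$ are trivial, and let $d_R^p$ and $d_R^q$ be the geometric distance functions on $\Gamma$ defined using $p$ and $q$ respectively. Then $d_R^p$ and $d_R^q$ are Lipschitz equivalent.
   Context: A symmetric space $(X,d)$ is a differentiable manifold $X$ which is a metric space with a Riemannian distance function $d$ (the distance function of a Riemannian metric), such that some group $G$ acts transitively and by isometries on $X$, and there are a point $0\in X$ and an element $k\in G$ with $k\cdot 0=0$ and differential $Dk(0)=-I$. A discrete group of isometries of $X$ is a subgroup of the isometry group of $X$ that is discrete in the compact-open topology. For $p\in X$ with trivial stabiliser in $\Gamma$, the geometric distance function is $d_R^p(\gamma_1,\gamma_2)=d(\gamma_1p,\gamma_2p)$ for $\gamma_1,\gamma_2\in\Gamma$. Two distance functions $\delta,\delta'$ on $\Gamma$ are Lipschitz equivalent if there are constants $c,C>0$ such that $c\,\delta(\gamma_1,\gamma_2)\le\delta'(\gamma_1,\gamma_2)\le C\,\delta(\gamma_1,\gamma_2)$ for all $\gamma_1,\gamma_2\in\Gamma$. *)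

theory Defs
  imports "HOL-Analysis.Analysis" "HOL-Algebra.Group_Action"
begin

subsection \<open>Smooth maps between open subsets of vector spaces\<close>

text \<open>For open \<open>S\<close> in a finite-dimensional space, \<open>Ck_on k f S\<close> says that \<open>f\<close> is of class
  \<open>C\<^sup>k\<close> on \<open>S\<close>; the recursion runs over all directional derivatives.\<close>

primrec Ck_on :: "nat \<Rightarrow> ('a::real_normed_vector \<Rightarrow> 'b::real_normed_vector) \<Rightarrow> 'a set \<Rightarrow> bool" where
  "Ck_on 0 f S \<longleftrightarrow> continuous_on S f"
| "Ck_on (Suc k) f S \<longleftrightarrow>
     (\<forall>x\<in>S. f differentiable (at x)) \<and>
     (\<forall>v. Ck_on k (\<lambda>x. frechet_derivative f (at x) v) S)"

definition smooth_on :: "('a::real_normed_vector \<Rightarrow> 'b::real_normed_vector) \<Rightarrow> 'a set \<Rightarrow> bool" where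
  "smooth_on f S \<longleftrightarrow> (\<forall>k. Ck_on k f S)"


subsection \<open>Smooth manifolds\<close>

text \<open>The manifold is the whole type \<open>'a\<close> and its topology is the one of the type. Charts take values
  in a finite-dimensional inner product space \<open>'e\<close>; unlike the class \<open>euclidean_space\<close>, the class
  \<open>real_inner\<close> also contains spaces of dimension 0. An atlas need not be maximal. Second countability
  is not demanded.\<close>

type_synonym ('a, 'e) chart = "'a set \<times> ('a \<Rightarrow> 'e)"

abbreviation chart_dom :: "('a, 'e) chart \<Rightarrow> 'a set" where
  "chart_dom \<equiv> fst"

abbreviation chart_map :: "('a, 'e) chart \<Rightarrow> 'a \<Rightarrow> 'e" where
  "chart_map \<equiv> snd"

definition chart_inv :: "('a, 'e) chart \<Rightarrow> 'e \<Rightarrow> 'a" where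
  "chart_inv \<kappa> = inv_into (chart_dom \<kappa>) (chart_map \<kappa>)"

definition is_chart :: "('a::topological_space, 'e::real_inner) chart \<Rightarrow> bool" where
  "is_chart \<kappa> \<longleftrightarrow>
     open (chart_dom \<kappa>) \<and> open (chart_map \<kappa> ` chart_dom \<kappa>) \<and>
     homeomorphism (chart_dom \<kappa>) (chart_map \<kappa> ` chart_dom \<kappa>) (chart_map \<kappa>) (chart_inv \<kappa>)"

definition transition :: "('a, 'e) chart \<Rightarrow> ('a, 'e) chart \<Rightarrow> 'e \<Rightarrow> 'e" where
  "transition \<kappa> \<kappa>' = chart_map \<kappa>' \<circ> chart_inv \<kappa>"

definition smooth_atlas :: "('a::topological_space, 'e::real_inner) chart set \<Rightarrow> bool" where
  "smooth_atlas A \<longleftrightarrow>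
     (\<exists>B::'e set. finite B \<and> span B = UNIV) \<and>
     (\<forall>\<kappa>\<in>A. is_chart \<kappa>) \<and>
     (\<Union>\<kappa>\<in>A. chart_dom \<kappa>) = UNIV \<and>
     (\<forall>\<kappa>\<in>A. \<forall>\<kappa>'\<in>A.
        smooth_on (transition \<kappa> \<kappa>') (chart_map \<kappa> ` (chart_dom \<kappa> \<inter> chart_dom \<kappa>')))"

definition charts_at :: "('a, 'e) chart set \<Rightarrow> 'a \<Rightarrow> ('a, 'e) chart set" where
  "charts_at A x = {\<kappa>\<in>A. x \<in> chart_dom \<kappa>}"


subsection \<open>Tangent vectors and differentials\<close>

text \<open>A tangent vector at \<open>x\<close> is the family of its coordinate vectors in the charts around \<open>x\<close>
  (and is 0 at all other charts), related by the derivatives of the chart transitions.\<close>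

type_synonym ('a, 'e) tangent = "('a, 'e) chart \<Rightarrow> 'e"

definition tangent_space ::
    "('a::topological_space, 'e::real_inner) chart set \<Rightarrow> 'a \<Rightarrow> ('a, 'e) tangent set" where
  "tangent_space A x =
     {v. (\<forall>\<kappa>\<in>charts_at A x. \<forall>\<kappa>'\<in>charts_at A x.
            v \<kappa>' = frechet_derivative (transition \<kappa> \<kappa>') (at (chart_map \<kappa> x)) (v \<kappa>)) \<and>
         (\<forall>\<kappa>. \<kappa> \<notin> charts_at A x \<longrightarrow> v \<kappa> = 0)}"

text \<open>The tangent vector at \<open>x\<close> with coordinate vector \<open>u\<close> in the chart \<open>\<kappa>\<close>.\<close>

definition coord_tangent ::
    "('a::topological_space, 'e::real_inner) chart set \<Rightarrow> ('a, 'e) chart \<Rightarrow> 'a \<Rightarrow> 'e \<Rightarrow> ('a, 'e) tangent" where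
  "coord_tangent A \<kappa> x u =
     (\<lambda>\<kappa>'. if \<kappa>' \<in> charts_at A x
           then frechet_derivative (transition \<kappa> \<kappa>') (at (chart_map \<kappa> x)) u else 0)"

text \<open>\<open>f\<close> is differentiable at \<open>x\<close> and its differential \<open>T\<^sub>xX \<rightarrow> T\<^bsub>f x\<^esub>X\<close> is \<open>D\<close>.\<close>

definition has_differential ::
    "('a::t2_space, 'e::real_inner) chart set \<Rightarrow> ('a \<Rightarrow> 'a) \<Rightarrow> 'a \<Rightarrow>
     (('a, 'e) tangent \<Rightarrow> ('a, 'e) tangent) \<Rightarrow> bool" where
  "has_differential A f x D \<longleftrightarrow>
     isCont f x \<and>
     (\<forall>v\<in>tangent_space A x. D v \<in> tangent_space A (f x)) \<and>
     (\<forall>\<kappa>\<in>charts_at A x. \<forall>\<kappa>'\<in>charts_at A (f x).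
        (chart_map \<kappa>' \<circ> f \<circ> chart_inv \<kappa>) differentiable (at (chart_map \<kappa> x)) \<and>
        (\<forall>v\<in>tangent_space A x.
           D v \<kappa>' = frechet_derivative (chart_map \<kappa>' \<circ> f \<circ> chart_inv \<kappa>) (at (chart_map \<kappa> x)) (v \<kappa>)))"


subsection \<open>Riemannian metrics and their distance functions\<close>

definition riemannian_metric ::
    "('a::topological_space, 'e::real_inner) chart set \<Rightarrow>
     ('a \<Rightarrow> ('a, 'e) tangent \<Rightarrow> ('a, 'e) tangent \<Rightarrow> real) \<Rightarrow> bool" where
  "riemannian_metric A g \<longleftrightarrow>
     (\<forall>x. \<forall>u\<in>tangent_space A x. \<forall>v\<in>tangent_space A x. g x u v = g x v u) \<and>
     (\<forall>x. \<forall>u\<in>tangent_space A x. \<forall>v\<in>tangent_space A x. \<forall>w\<in>tangent_space A x. \<forall>a b.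
        g x (\<lambda>\<kappa>. a *\<^sub>R u \<kappa> + b *\<^sub>R v \<kappa>) w = a * g x u w + b * g x v w) \<and>
     (\<forall>x. \<forall>u\<in>tangent_space A x. u \<noteq> (\<lambda>\<kappa>. 0) \<longrightarrow> g x u u > 0) \<and>
     (\<forall>\<kappa>\<in>A. \<forall>u v.
        smooth_on (\<lambda>y. let x = chart_inv \<kappa> y
                       in g x (coord_tangent A \<kappa> x u) (coord_tangent A \<kappa> x v))
                  (chart_map \<kappa> ` chart_dom \<kappa>))"

text \<open>At \<open>t = a\<close> and \<open>t = b\<close> the derivatives below are one-sided.\<close>

definition C1_curve ::
    "('a::topological_space, 'e::real_inner) chart set \<Rightarrow> (real \<Rightarrow> 'a) \<Rightarrow> real \<Rightarrow> real \<Rightarrow> bool" where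
  "C1_curve A c a b \<longleftrightarrow>
     continuous_on {a..b} c \<and>
     (\<forall>\<kappa>\<in>A. \<exists>D. continuous_on {t\<in>{a..b}. c t \<in> chart_dom \<kappa>} D \<and>
        (\<forall>t\<in>{a..b}. c t \<in> chart_dom \<kappa> \<longrightarrow>
           ((chart_map \<kappa> \<circ> c) has_vector_derivative D t) (at t within {a..b})))"

definition piecewise_C1_curve ::
    "('a::topological_space, 'e::real_inner) chart set \<Rightarrow> (real \<Rightarrow> 'a) \<Rightarrow> bool" where
  "piecewise_C1_curve A c \<longleftrightarrow>
     continuous_on {0..1} c \<and>
     (\<exists>S. finite S \<and> {0, 1} \<subseteq> S \<and> S \<subseteq> {0..1} \<and>
        (\<forall>a\<in>S. \<forall>b\<in>S. a < b \<and> {a<..<b} \<inter> S = {} \<longrightarrow> C1_curve A c a b))"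

definition velocity ::
    "('a::topological_space, 'e::real_inner) chart set \<Rightarrow> (real \<Rightarrow> 'a) \<Rightarrow> real \<Rightarrow> ('a, 'e) tangent" where
  "velocity A c t =
     (\<lambda>\<kappa>. if \<kappa> \<in> charts_at A (c t) then vector_derivative (chart_map \<kappa> \<circ> c) (at t) else 0)"

text \<open>The velocity of a piecewise \<open>C\<^sup>1\<close> curve is unspecified at the finitely many break points; these
  do not contribute to the integral.\<close>

definition curve_length ::
    "('a::topological_space, 'e::real_inner) chart set \<Rightarrow>
     ('a \<Rightarrow> ('a, 'e) tangent \<Rightarrow> ('a, 'e) tangent \<Rightarrow> real) \<Rightarrow> (real \<Rightarrow> 'a) \<Rightarrow> ennreal" where
  "curve_length A g c =
     (\<integral>\<^sup>+t\<in>{0..1}. ennreal (sqrt (g (c t) (velocity A c t) (velocity A c t))) \<partial>lborel)"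

text \<open>The infimum is \<open>\<infinity>\<close> if \<open>x\<close> and \<open>y\<close> cannot be joined by a curve. Hence a manifold
  on which it agrees with a real-valued distance function is connected.\<close>

definition riemannian_dist ::
    "('a::topological_space, 'e::real_inner) chart set \<Rightarrow>
     ('a \<Rightarrow> ('a, 'e) tangent \<Rightarrow> ('a, 'e) tangent \<Rightarrow> real) \<Rightarrow> 'a \<Rightarrow> 'a \<Rightarrow> ennreal" where
  "riemannian_dist A g x y =
     (INF c\<in>{c. piecewise_C1_curve A c \<and> c 0 = x \<and> c 1 = y}. curve_length A g c)"


subsection \<open>Symmetric spaces\<close>

definition symmetric_space ::
    "('a::metric_space, 'e::real_inner) chart set \<Rightarrow> ('g, 'm) monoid_scheme \<Rightarrow> ('g \<Rightarrow> 'a \<Rightarrow> 'a) \<Rightarrow> bool" where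
  "symmetric_space A G act \<longleftrightarrow>
     smooth_atlas A \<and>
     (\<exists>g. riemannian_metric A g \<and> (\<forall>x y. ennreal (dist x y) = riemannian_dist A g x y)) \<and>
     transitive_action G UNIV act \<and>
     (\<forall>h\<in>carrier G. \<forall>x y. dist (act h x) (act h y) = dist x y) \<and>
     (\<exists>x\<^sub>0. \<exists>k\<in>carrier G. act k x\<^sub>0 = x\<^sub>0 \<and> has_differential A (act k) x\<^sub>0 (\<lambda>v \<kappa>. - v \<kappa>))"


subsection \<open>Discrete groups of isometries\<close>

definition isometry_group :: "('a::metric_space \<Rightarrow> 'a) monoid" where
  "isometry_group =
     \<lparr>carrier = {f. bij f \<and> (\<forall>x y. dist (f x) (f y) = dist x y)}, mult = (\<circ>), one = id\<rparr>"

definition compact_open_topology ::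
    "('a::topological_space \<Rightarrow> 'b::topological_space) topology" where
  "compact_open_topology =
     topology_generated_by
       {{f. continuous_on UNIV f \<and> f ` K \<subseteq> U} | K U. compact K \<and> open U}"

definition discrete_isometry_group :: "('a::metric_space \<Rightarrow> 'a) set \<Rightarrow> bool" where
  "discrete_isometry_group \<Gamma> \<longleftrightarrow>
     subgroup \<Gamma> isometry_group \<and>
     subtopology compact_open_topology \<Gamma> = discrete_topology \<Gamma>"

definition isometry_stabilizer :: "('a::metric_space \<Rightarrow> 'a) set \<Rightarrow> 'a \<Rightarrow> ('a \<Rightarrow> 'a) set" where
  "isometry_stabilizer \<Gamma> p = stabilizer (isometry_group\<lparr>carrier := \<Gamma>\<rparr>) (\<lambda>\<gamma>. \<gamma>) p"

definition geometric_dist :: "'a::metric_space \<Rightarrow> ('a \<Rightarrow> 'a) \<Rightarrow> ('a \<Rightarrow> 'a) \<Rightarrow> real" where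
  "geometric_dist p \<gamma>\<^sub>1 \<gamma>\<^sub>2 = dist (\<gamma>\<^sub>1 p) (\<gamma>\<^sub>2 p)"

definition lipschitz_equivalent :: "'b set \<Rightarrow> ('b \<Rightarrow> 'b \<Rightarrow> real) \<Rightarrow> ('b \<Rightarrow> 'b \<Rightarrow> real) \<Rightarrow> bool" where
  "lipschitz_equivalent \<Gamma> \<delta> \<delta>' \<longleftrightarrow>
     (\<exists>c>0. \<exists>C>0. \<forall>\<gamma>\<^sub>1\<in>\<Gamma>. \<forall>\<gamma>\<^sub>2\<in>\<Gamma>.
        c * \<delta> \<gamma>\<^sub>1 \<gamma>\<^sub>2 \<le> \<delta>' \<gamma>\<^sub>1 \<gamma>\<^sub>2 \<and> \<delta>' \<gamma>\<^sub>1 \<gamma>\<^sub>2 \<le> C * \<delta> \<gamma>\<^sub>1 \<gamma>\<^sub>2)"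

end

theory Submission
  imports Defs
begin

text \<open>If \<open>d(\<gamma>p, p) \<ge> r > 0\<close> for all \<open>\<gamma> \<noteq> 1\<close> in \<open>\<Gamma>\<close>, the triangle inequality through
  \<open>\<gamma>\<^sub>1p\<close> and \<open>\<gamma>\<^sub>2p\<close> gives \<open>d(\<gamma>\<^sub>1q, \<gamma>\<^sub>2q) \<le> (1 + 2d(p,q)/r) d(\<gamma>\<^sub>1p, \<gamma>\<^sub>2p)\<close>, so it suffices to find \<open>r\<close>.
  By homogeneity there is an \<open>\<epsilon>\<close> such that all \<open>\<epsilon>\<close>-balls are relatively compact. Let \<open>S\<close> be the set
  of \<open>\<gamma> \<in> \<Gamma>\<close> with \<open>d(\<gamma>p, p) < \<epsilon>\<close>. The points \<open>x\<close> whose orbit \<open>Sx\<close> is relatively compact form a set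
  that is open and closed, hence everything, since \<open>X\<close> is connected. This replaces the
  Hopf--Rinow theorem. As an isometry close enough to the identity on a suitable finite
  set is not in \<open>\<Gamma> - {1}\<close>, a pigeonhole argument shows that \<open>S\<close> is finite.\<close>

subsection \<open>Finite-dimensional inner product spaces\<close>

text \<open>Induction on \<open>C\<close>: the new vector contributes the compact segment
  \<open>L\<close>, and the Minkowski sum of two compact sets is compact. This is the source of
  compactness for the coordinate space, which is only assumed to be a \<open>real_inner\<close> type
  with a finite spanning set.\<close>

lemma bounded_combinations_subset_compact:
  fixes C :: "'e::real_normed_vector set"
  assumes "finite C"
  shows "\<exists>K. compact K \<and> (\<forall>a. (\<forall>e\<in>C. \<bar>a e\<bar> \<le> b e) \<longrightarrow> (\<Sum>e\<in>C. a e *\<^sub>R e) \<in> K)"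
  using assms
proof induction
  case empty
  show ?case by (rule exI[of _ "{0}"]) simp
next
  case (insert e C)
  then obtain K where K: "compact K" "\<And>a. \<forall>e\<in>C. \<bar>a e\<bar> \<le> b e \<Longrightarrow> (\<Sum>e\<in>C. a e *\<^sub>R e) \<in> K"
    by blast
  define L where "L = (\<lambda>t. t *\<^sub>R e) ` {- b e..b e}"
  have "compact L"
    unfolding L_def by (intro compact_continuous_image continuous_intros compact_Icc)
  then have "compact {x + y | x y. x \<in> L \<and> y \<in> K}"
    using K(1) by (rule compact_sums)
  moreover have "(\<Sum>e\<in>insert e C. a e *\<^sub>R e) \<in> {x + y | x y. x \<in> L \<and> y \<in> K}"
    if "\<forall>e\<in>insert e C. \<bar>a e\<bar> \<le> b e" for a
  proof -
    have "a e *\<^sub>R e \<in> L"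
      using that by (auto simp: L_def abs_le_iff)
    moreover have "(\<Sum>e\<in>C. a e *\<^sub>R e) \<in> K"
      using K(2) that by simp
    ultimately show ?thesis
      using insert.hyps by auto
  qed
  ultimately show ?case by blast
qed

text \<open>Gram-Schmidt gives a finite orthogonal spanning set. Cauchy-Schwarz bounds the
  coordinates of a vector of norm at most \<open>r\<close>, so the ball around 0 is a closed subset
  of a compact set; translation gives the other centres.\<close>

lemma compact_cball_finite_span:
  fixes B :: "'e::real_inner set"
  assumes "finite B" "span B = UNIV"
  shows "compact (cball (z::'e) r)"
proof -
  obtain C :: "'e set" where C: "finite C" "span C = UNIV" "pairwise orthogonal C"
    using basis_orthogonal[OF assms(1)] assms(2) by auto
  obtain K :: "'e set" where K: "compact K"
    "\<And>a. \<forall>e\<in>C. \<bar>a e\<bar> \<le> r / norm e \<Longrightarrow> (\<Sum>e\<in>C. a e *\<^sub>R e) \<in> K"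
    using bounded_combinations_subset_compact[OF C(1), of "\<lambda>e. r / norm e"] by blast
  have "cball 0 r \<subseteq> K"
  proof
    fix x :: 'e
    assume "x \<in> cball 0 r"
    then have x: "norm x \<le> r" by simp
    then have r: "0 \<le> r" using norm_ge_zero[of x] by linarith
    have "x \<in> range (\<lambda>u. \<Sum>e\<in>C. u e *\<^sub>R e)"
      using C(2) span_finite[OF C(1)] by simp
    then obtain u where u: "x = (\<Sum>e\<in>C. u e *\<^sub>R e)" by blast
    \<comment> \<open>\<open>C\<close> may contain 0. Its coefficient is reset to 0 because
      \<open>r / norm 0\<close> is 0 in HOL, so the bound demands exactly that.\<close>
    define a where "a e = (if e = 0 then 0 else u e)" for e
    have "x = (\<Sum>e\<in>C. a e *\<^sub>R e)"
      unfolding u a_def by (rule sum.cong) auto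
    moreover have "\<bar>a e\<bar> \<le> r / norm e" if "e \<in> C" for e
    proof (cases "e = 0")
      case False
      \<comment> \<open>By orthogonality, the inner product with \<open>e\<close> isolates the
        coefficient of \<open>e\<close>.\<close>
      have "x \<bullet> e = (\<Sum>f\<in>C. u f * (f \<bullet> e))"
        unfolding u by (simp add: inner_sum_left)
      also have "\<dots> = (\<Sum>f\<in>C. if f = e then u e * (e \<bullet> e) else 0)"
        using C(3) that by (intro sum.cong) (auto simp: pairwise_def orthogonal_def)
      also have "\<dots> = u e * (norm e)\<^sup>2"
        using C(1) that by (simp add: power2_norm_eq_inner)
      finally have "\<bar>u e\<bar> * (norm e)\<^sup>2 = \<bar>x \<bullet> e\<bar>"
        by (simp add: abs_mult)
      also have "\<dots> \<le> r * norm e"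
        by (rule order_trans[OF Cauchy_Schwarz_ineq2 mult_right_mono[OF x norm_ge_zero]])
      finally show ?thesis
        using False by (simp add: a_def power2_eq_square pos_le_divide_eq mult.assoc[symmetric])
    qed (simp add: a_def r)
    ultimately show "x \<in> K" using K(2)[of a] by simp
  qed
  then have "compact (cball (0::'e) r)"
    using compact_Int_closed[OF K(1) closed_cball[of 0 r]] by (simp add: Int_absorb1)
  then have "compact ((+) z ` cball 0 r)"
    by (rule compact_translation)
  then show ?thesis
    by simp
qed

subsection \<open>Topology of symmetric spaces\<close>

text \<open>A small closed ball in the image of a chart is compact. \<open>K\<close> is its image
  under the inverse chart, and \<open>U\<close> is the preimage of the open ball.\<close>

lemma smooth_atlas_compact_neighbourhood:
  fixes A :: "('a::topological_space, 'e::real_inner) chart set" and x :: 'a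
  assumes "smooth_atlas A"
  shows "\<exists>U K. open U \<and> x \<in> U \<and> U \<subseteq> K \<and> compact K"
proof -
  obtain B :: "'e set" where B: "finite B" "span B = UNIV"
    using assms by (auto simp: smooth_atlas_def)
  obtain \<kappa> where \<kappa>: "\<kappa> \<in> A" "x \<in> chart_dom \<kappa>"
    using assms unfolding smooth_atlas_def by blast
  have "is_chart \<kappa>"
    using assms \<kappa> unfolding smooth_atlas_def by blast
  then have dom: "open (chart_dom \<kappa>)" and ran: "open (chart_map \<kappa> ` chart_dom \<kappa>)"
    and hom: "homeomorphism (chart_dom \<kappa>) (chart_map \<kappa> ` chart_dom \<kappa>) (chart_map \<kappa>) (chart_inv \<kappa>)"
    unfolding is_chart_def by blast+
  obtain r where r: "r > 0" "cball (chart_map \<kappa> x) r \<subseteq> chart_map \<kappa> ` chart_dom \<kappa>"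
    using ran \<kappa>(2) open_contains_cball by blast
  define U where "U = chart_dom \<kappa> \<inter> chart_map \<kappa> -` ball (chart_map \<kappa> x) r"
  define K where "K = chart_inv \<kappa> ` cball (chart_map \<kappa> x) r"
  have "open U"
    unfolding U_def
    using hom dom by (intro continuous_open_preimage) (auto simp: homeomorphism_def)
  moreover have "compact K"
    unfolding K_def using hom r(2) compact_cball_finite_span[OF B]
    by (intro compact_continuous_image) (auto simp: homeomorphism_def intro: continuous_on_subset)
  moreover have "U \<subseteq> K"
  proof
    fix y assume "y \<in> U"
    then have "y = chart_inv \<kappa> (chart_map \<kappa> y)" "chart_map \<kappa> y \<in> cball (chart_map \<kappa> x) r"
      using hom by (auto simp: U_def homeomorphism_def)
    then show "y \<in> K"
      unfolding K_def by (rule image_eqI)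
  qed
  moreover have "x \<in> U"
    using \<kappa> r by (simp add: U_def)
  ultimately show ?thesis by blast
qed

lemma isometry_continuous_on:
  assumes "\<And>x y. dist (f x) (f y) = dist x y"
  shows "continuous_on S f"
  using assms unfolding continuous_on_iff by auto

text \<open>A compact neighbourhood of one base point is carried to every other point by the
  transitive action; isometries preserve the radius, so one \<epsilon> serves all points.\<close>

lemma symmetric_space_uniformly_locally_compact:
  fixes A :: "('a::metric_space, 'e::real_inner) chart set"
  assumes "symmetric_space A G act"
  shows "\<exists>\<epsilon>>0. \<forall>x::'a. \<exists>K. compact K \<and> ball x \<epsilon> \<subseteq> K"
proof -
  have act: "transitive_action G UNIV act"
    and iso: "\<And>h x y. h \<in> carrier G \<Longrightarrow> dist (act h x) (act h y) = dist x y"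
    and "smooth_atlas A"
    using assms by (simp_all add: symmetric_space_def)
  \<comment> \<open>An arbitrary base point; by transitivity its choice does not matter.\<close>
  define x\<^sub>0 :: 'a where "x\<^sub>0 = undefined"
  obtain U K where UK: "open U" "x\<^sub>0 \<in> U" "U \<subseteq> K" "compact K"
    using smooth_atlas_compact_neighbourhood[OF \<open>smooth_atlas A\<close>] by blast
  then obtain \<epsilon> where \<epsilon>: "\<epsilon> > 0" "ball x\<^sub>0 \<epsilon> \<subseteq> K"
    unfolding open_contains_ball by (metis subset_trans)
  have "\<exists>K. compact K \<and> ball x \<epsilon> \<subseteq> K" for x :: 'a
  proof -
    obtain h where h: "h \<in> carrier G" "act h x\<^sub>0 = x"
      using transitive_action.unique_orbit[OF act, of x\<^sub>0 x] by auto
    have surj: "act h ` UNIV = UNIV"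
      using group_action.surj_prop[OF transitive_action.axioms(1)[OF act] h(1)] .
    have "compact (act h ` K)"
      using iso[OF h(1)] UK(4) by (intro compact_continuous_image isometry_continuous_on)
    moreover have "ball x \<epsilon> \<subseteq> act h ` K"
    proof
      fix y assume y: "y \<in> ball x \<epsilon>"
      obtain z where z: "y = act h z" using surj by (metis surjD)
      have "z \<in> ball x\<^sub>0 \<epsilon>"
        using y z h iso[OF h(1), of x\<^sub>0 z] by simp
      then show "y \<in> act h ` K" using \<epsilon> z by blast
    qed
    ultimately show ?thesis by blast
  qed
  then show ?thesis using \<epsilon>(1) by blast
qed

text \<open>The Riemannian distance agrees with a real number, hence is finite. The infimum over an
  empty set of curves would be \<infinity>, so a joining curve exists.\<close>

lemma symmetric_space_connected:
  fixes A :: "('a::metric_space, 'e::real_inner) chart set"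
  assumes "symmetric_space A G act"
  shows "connected (UNIV :: 'a set)"
proof (rule path_connected_imp_connected, unfold path_connected_def, intro ballI)
  fix x y :: 'a
  obtain g where "ennreal (dist x y) = riemannian_dist A g x y"
    using assms unfolding symmetric_space_def by blast
  then have "riemannian_dist A g x y < \<infinity>"
    by (metis ennreal_less_top infinity_ennreal_def)
  then obtain c where c: "piecewise_C1_curve A c" "c 0 = x" "c 1 = y"
    unfolding riemannian_dist_def INF_less_iff by blast
  then show "\<exists>c. path c \<and> path_image c \<subseteq> UNIV \<and> pathstart c = x \<and> pathfinish c = y"
    by (auto simp: piecewise_C1_curve_def path_def pathstart_def pathfinish_def)
qed

subsection \<open>Sets of isometries\<close>

lemma compact_imp_finite_ball_cover:
  assumes "compact K" "\<epsilon> > 0"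
  shows "\<exists>Z. finite Z \<and> K \<subseteq> (\<Union>z\<in>Z. ball z \<epsilon>)"
  using assms(1)[unfolded compact_eq_totally_bounded] assms(2) by simp

text \<open>Relative compactness of the orbit passes between any two points less than \<epsilon>/2
  apart, in both directions. The set where it holds is therefore clopen, and it contains
  \<open>p\<close>.\<close>

lemma relatively_compact_orbits:
  fixes S :: "('a::metric_space \<Rightarrow> 'a) set"
  assumes conn: "connected (UNIV :: 'a set)"
    and \<epsilon>: "\<epsilon> > 0" "\<And>x::'a. \<exists>K. compact K \<and> ball x \<epsilon> \<subseteq> K"
    and iso: "\<And>\<gamma> x y. \<gamma> \<in> S \<Longrightarrow> dist (\<gamma> x) (\<gamma> y) = dist x y"
    and p: "compact L" "\<And>\<gamma>. \<gamma> \<in> S \<Longrightarrow> \<gamma> p \<in> L"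
  shows "\<exists>K. compact K \<and> (\<forall>\<gamma>\<in>S. \<gamma> x \<in> K)"
proof -
  define P where "P x \<longleftrightarrow> (\<exists>K. compact K \<and> (\<forall>\<gamma>\<in>S. \<gamma> x \<in> K))" for x :: 'a
  have step: "P y" if Px: "P x" and xy: "dist x y < \<epsilon> / 2" for x y
  proof -
    obtain K where K: "compact K" "\<forall>\<gamma>\<in>S. \<gamma> x \<in> K"
      using Px unfolding P_def by blast
    obtain Z where Z: "finite Z" "K \<subseteq> (\<Union>z\<in>Z. ball z (\<epsilon> / 2))"
      using compact_imp_finite_ball_cover[OF K(1), of "\<epsilon> / 2"] \<epsilon>(1) by auto
    obtain k :: "'a \<Rightarrow> 'a set" where k: "\<And>z. compact (k z)" "\<And>z. ball z \<epsilon> \<subseteq> k z"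
      using \<epsilon>(2) by metis
    \<comment> \<open>Some centre \<open>z\<close> is within \<epsilon>/2 of
      \<open>\<gamma> x\<close>, and \<open>\<gamma> x\<close> is within \<epsilon>/2 of
      \<open>\<gamma> y\<close>. Thus \<open>\<gamma> y\<close> lies in one of the finitely many
      balls of radius \<epsilon> around \<open>Z\<close>.\<close>
    have "\<gamma> y \<in> (\<Union>z\<in>Z. k z)" if "\<gamma> \<in> S" for \<gamma>
    proof -
      obtain z where z: "z \<in> Z" "dist z (\<gamma> x) < \<epsilon> / 2"
        using K(2) Z(2) \<open>\<gamma> \<in> S\<close> by force
      have "dist z (\<gamma> y) < \<epsilon>"
        using dist_triangle[of z "\<gamma> y" "\<gamma> x"] iso[OF \<open>\<gamma> \<in> S\<close>, of x y] z(2) xy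
        by linarith
      then show ?thesis using k(2) z(1) by fastforce
    qed
    moreover have "compact (\<Union>z\<in>Z. k z)"
      using Z(1) k(1) by blast
    ultimately show ?thesis unfolding P_def by blast
  qed
  have "0 < \<epsilon> / 2" using \<epsilon>(1) by simp
  moreover have "P y \<longleftrightarrow> P x" if "dist y x < \<epsilon> / 2" for x y
    using step[of x y] step[of y x] that by (auto simp: dist_commute)
  ultimately have "open {x. P x}" "open (- {x. P x})"
    unfolding open_dist mem_Collect_eq Compl_iff by blast+
  then have "{x. P x} = {} \<or> {x. P x} = UNIV"
    using conn unfolding connected_clopen closed_def by auto
  moreover have "P p"
    unfolding P_def using p by blast
  ultimately have "P x" by blast
  then show ?thesis unfolding P_def .
qed

text \<open>Isometries are equicontinuous: closeness on a finite net of a compact set forces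
  closeness on the whole set. Hence, among isometries, finitely many points suffice to describe a
  neighbourhood inside \<open>T\<close>.\<close>

lemma compact_open_isometry_neighbourhood:
  fixes f :: "'a::metric_space \<Rightarrow> 'b::metric_space"
  assumes T: "openin compact_open_topology T" and "f \<in> T"
    and f: "\<And>x y. dist (f x) (f y) = dist x y"
  shows "\<exists>F \<epsilon>. finite F \<and> \<epsilon> > 0 \<and>
    (\<forall>g. (\<forall>x y. dist (g x) (g y) = dist x y) \<longrightarrow> (\<forall>x\<in>F. dist (g x) (f x) < \<epsilon>) \<longrightarrow> g \<in> T)"
proof -
  define P where "P T \<longleftrightarrow> (\<exists>F \<epsilon>. finite F \<and> \<epsilon> > 0 \<and>
    (\<forall>g. (\<forall>x y. dist (g x) (g y) = dist x y) \<longrightarrow> (\<forall>x\<in>F. dist (g x) (f x) < \<epsilon>) \<longrightarrow> g \<in> T))"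
    for T :: "('a \<Rightarrow> 'b) set"
  have "generate_topology_on {{f :: 'a \<Rightarrow> 'b. continuous_on UNIV f \<and> f ` K \<subseteq> U} | K U. compact K \<and> open U} T"
    using T unfolding compact_open_topology_def by (rule openin_topology_generated_by)
  then have "f \<in> T \<Longrightarrow> P T"
  proof induction
    case Empty
    then show ?case by simp
  next
    case (Int a b)
    then obtain F\<^sub>1 \<epsilon>\<^sub>1 F\<^sub>2 \<epsilon>\<^sub>2 where
      "finite F\<^sub>1" "\<epsilon>\<^sub>1 > 0" "finite F\<^sub>2" "\<epsilon>\<^sub>2 > 0" and
      *: "\<And>g. \<forall>x y. dist (g x) (g y) = dist x y \<Longrightarrow> \<forall>x\<in>F\<^sub>1. dist (g x) (f x) < \<epsilon>\<^sub>1 \<Longrightarrow> g \<in> a"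
      "\<And>g. \<forall>x y. dist (g x) (g y) = dist x y \<Longrightarrow> \<forall>x\<in>F\<^sub>2. dist (g x) (f x) < \<epsilon>\<^sub>2 \<Longrightarrow> g \<in> b"
      unfolding P_def by auto
    then show ?case
      unfolding P_def
      by (intro exI[of _ "F\<^sub>1 \<union> F\<^sub>2"] exI[of _ "min \<epsilon>\<^sub>1 \<epsilon>\<^sub>2"]) auto
  next
    case (UN \<T>)
    then obtain k where "k \<in> \<T>" "P k" by blast
    then show ?case unfolding P_def by (meson UnionI)
  next
    case (Basis s)
    then obtain K U where s: "s = {f. continuous_on UNIV f \<and> f ` K \<subseteq> U}" and KU: "compact K" "open U"
      by blast
    have "compact (f ` K)" "f ` K \<subseteq> U"
      using KU(1) Basis.prems s by (auto intro: compact_continuous_image isometry_continuous_on f)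
    then obtain d where d: "d > 0" "(\<Union>x\<in>f ` K. ball x d) \<subseteq> U"
      using compact_subset_open_imp_ball_epsilon_subset KU(2) by blast
    obtain F where F: "finite F" "K \<subseteq> (\<Union>x\<in>F. ball x (d / 3))"
      using compact_imp_finite_ball_cover[OF KU(1), of "d / 3"] d(1) by auto
    have "g \<in> s" if g: "\<forall>x y. dist (g x) (g y) = dist x y" "\<forall>x\<in>F. dist (g x) (f x) < d / 3" for g
    proof -
      have "g y \<in> U" if "y \<in> K" for y
      proof -
        obtain x where x: "x \<in> F" "dist x y < d / 3"
          using F(2) \<open>y \<in> K\<close> by force
        have "dist (g y) (g x) = dist y x"
          using g(1) by blast
        moreover have "dist (g x) (f x) < d / 3"
          using g(2) x(1) by blast
        ultimately have "dist (f y) (g y) < d"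
          using x(2) dist_triangle3[of "f y" "g y" "f x"] dist_triangle[of "f x" "g y" "g x"]
            f[of x y] by (simp add: dist_commute)
        then have "g y \<in> (\<Union>x\<in>f ` K. ball x d)"
          using \<open>y \<in> K\<close> by auto
        then show ?thesis
          using d(2) by blast
      qed
      moreover have "continuous_on UNIV g"
        using g(1) by (intro isometry_continuous_on) blast
      ultimately show ?thesis unfolding s by blast
    qed
    then show ?case
      unfolding P_def using F(1) d(1) by (intro exI[of _ F] exI[of _ "d / 3"]) auto
  qed
  then show ?thesis
    using \<open>f \<in> T\<close> unfolding P_def by blast
qed

lemma group_isometry_group: "group (isometry_group :: ('a::metric_space \<Rightarrow> 'a) monoid)"
proof (rule groupI)
  fix f :: "'a \<Rightarrow> 'a"
  assume "f \<in> carrier isometry_group"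
  then have f: "bij f" "\<And>x y. dist (f x) (f y) = dist x y"
    by (auto simp: isometry_group_def)
  have "dist (inv_into UNIV f x) (inv_into UNIV f y) = dist x y" for x y
    using f(2)[of "inv_into UNIV f x" "inv_into UNIV f y"] f(1) by (simp add: bij_is_surj surj_f_inv_f)
  then have "inv_into UNIV f \<in> carrier isometry_group"
    using f(1) by (simp add: isometry_group_def bij_imp_bij_inv)
  moreover have "inv_into UNIV f \<circ> f = id"
    using f(1) by (simp add: bij_is_inj)
  ultimately show "\<exists>g\<in>carrier isometry_group. g \<otimes>\<^bsub>isometry_group\<^esub> f = \<one>\<^bsub>isometry_group\<^esub>"
    by (auto simp: isometry_group_def)
qed (auto simp: isometry_group_def bij_comp)

text \<open>Take \<delta> to be the inverse of \<gamma>' followed by precomposition with \<gamma>,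
  that is \<open>inv \<gamma>' \<circ> \<gamma>\<close>. As \<gamma>' is an isometry, the distance
  from \<open>\<gamma> x\<close> to \<open>\<gamma>' x\<close> equals that from
  \<open>\<delta> x\<close> to \<open>x\<close>, which reduces questions about pairs to the
  identity.\<close>

lemma isometry_subgroup_left_quotient:
  assumes sub: "subgroup \<Gamma> isometry_group" and "\<gamma> \<in> \<Gamma>" "\<gamma>' \<in> \<Gamma>"
  obtains \<delta> where "\<delta> \<in> \<Gamma>" "\<gamma> = \<gamma>' \<circ> \<delta>"
proof
  let ?i = "m_inv isometry_group \<gamma>'"
  have "?i \<in> \<Gamma>"
    using subgroup.m_inv_closed[OF sub assms(3)] .
  then show "?i \<circ> \<gamma> \<in> \<Gamma>"
    using subgroup.m_closed[OF sub _ assms(2)] by (simp add: isometry_group_def)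
  have "\<gamma>' \<in> carrier isometry_group"
    using subgroup.subset[OF sub] assms(3) by blast
  then have "\<gamma>' \<circ> ?i = id"
    using group.r_inv[OF group_isometry_group, of \<gamma>'] by (simp add: isometry_group_def)
  then show "\<gamma> = \<gamma>' \<circ> (?i \<circ> \<gamma>)"
    by (simp add: comp_assoc[symmetric])
qed

text \<open>Discreteness yields a finite set \<open>F\<close> on which distinct elements of \<Gamma>
  cannot be uniformly \<epsilon>-close. Covering the orbits of the points of \<open>F\<close> by
  finitely many small balls leaves only finitely many elements in \<open>S\<close>.\<close>

lemma finite_isometries_relatively_compact_orbits:
  fixes \<Gamma> S :: "('a::metric_space \<Rightarrow> 'a) set"
  assumes \<Gamma>: "discrete_isometry_group \<Gamma>" and "S \<subseteq> \<Gamma>"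
    and orb: "\<And>x. \<exists>K. compact K \<and> (\<forall>\<gamma>\<in>S. \<gamma> x \<in> K)"
  shows "finite S"
proof -
  have sub: "subgroup \<Gamma> isometry_group"
    and top: "subtopology compact_open_topology \<Gamma> = discrete_topology \<Gamma>"
    using \<Gamma> unfolding discrete_isometry_group_def by blast+
  have iso: "dist (\<gamma> x) (\<gamma> y) = dist x y" if "\<gamma> \<in> \<Gamma>" for \<gamma> x y
    using subgroup.subset[OF sub] that unfolding isometry_group_def by auto
  have id: "id \<in> \<Gamma>"
    using subgroup.one_closed[OF sub] by (simp add: isometry_group_def)
  have "openin (subtopology compact_open_topology \<Gamma>) {id}"
    unfolding top using id by simp
  then obtain T where T: "openin compact_open_topology T" "{id} = T \<inter> \<Gamma>"
    unfolding openin_subtopology by blast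
  then have "id \<in> T" by blast
  obtain F \<epsilon> where F: "finite F" "\<epsilon> > 0"
    "\<And>g. \<forall>x y. dist (g x) (g y) = dist x y \<Longrightarrow> \<forall>x\<in>F. dist (g x) (id x) < \<epsilon> \<Longrightarrow> g \<in> T"
    using compact_open_isometry_neighbourhood[OF T(1) \<open>id \<in> T\<close>] by auto
  have near: "\<gamma> = \<gamma>'" if \<gamma>: "\<gamma> \<in> \<Gamma>" "\<gamma>' \<in> \<Gamma>" and close: "\<And>x. x \<in> F \<Longrightarrow> dist (\<gamma> x) (\<gamma>' x) < \<epsilon>" for \<gamma> \<gamma>'
  proof -
    obtain \<delta> where \<delta>: "\<delta> \<in> \<Gamma>" "\<gamma> = \<gamma>' \<circ> \<delta>"
      using isometry_subgroup_left_quotient[OF sub \<gamma>] by blast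
    have "\<delta> \<in> T"
    proof (rule F(3))
      show "\<forall>x y. dist (\<delta> x) (\<delta> y) = dist x y"
        using iso \<delta>(1) by simp
      show "\<forall>x\<in>F. dist (\<delta> x) (id x) < \<epsilon>"
        using close iso[OF \<gamma>(2)] \<delta>(2) by simp
    qed
    then have "\<delta> = id" using T(2) \<delta>(1) by blast
    then show "\<gamma> = \<gamma>'"
      using \<delta>(2) by simp
  qed
  obtain K :: "'a \<Rightarrow> 'a set" where K: "\<And>x. compact (K x)" "\<And>x \<gamma>. \<gamma> \<in> S \<Longrightarrow> \<gamma> x \<in> K x"
    using orb by metis
  have "\<exists>Z. finite Z \<and> K x \<subseteq> (\<Union>z\<in>Z. ball z (\<epsilon> / 2))" for x :: 'a
    using compact_imp_finite_ball_cover[OF K(1), of "\<epsilon> / 2" x] F(2) by simp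
  then obtain Z :: "'a \<Rightarrow> 'a set" where Z: "\<And>x. finite (Z x)" "\<And>x. K x \<subseteq> (\<Union>z\<in>Z x. ball z (\<epsilon> / 2))"
    by metis
  have "\<exists>z\<in>Z x. dist z (\<gamma> x) < \<epsilon> / 2" if "\<gamma> \<in> S" for \<gamma> :: "'a \<Rightarrow> 'a" and x
    using subsetD[OF Z(2) K(2)[OF that, of x]] by simp
  \<comment> \<open>\<open>c \<gamma>\<close> records, for each point \<open>x\<close>, a centre
    close to \<open>\<gamma> x\<close>. Restricted to \<open>F\<close>, it is a code from the finite
    set \<open>Pi\<^sub>E F Z\<close>; equal codes give distance below \<epsilon>/2 + \<epsilon>/2
    on \<open>F\<close>, so the code determines \<gamma>.\<close>
  then obtain c where c: "\<And>\<gamma> x. \<gamma> \<in> S \<Longrightarrow> c \<gamma> x \<in> Z x \<and> dist (c \<gamma> x) (\<gamma> x) < \<epsilon> / 2"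
    by metis
  have "inj_on (\<lambda>\<gamma>. restrict (c \<gamma>) F) S"
  proof (rule inj_onI)
    fix \<gamma> \<gamma>' assume S: "\<gamma> \<in> S" "\<gamma>' \<in> S" and eq: "restrict (c \<gamma>) F = restrict (c \<gamma>') F"
    have "dist (\<gamma> x) (\<gamma>' x) < \<epsilon>" if "x \<in> F" for x
    proof -
      have "c \<gamma> x = c \<gamma>' x" using eq that by (metis restrict_apply')
      then show ?thesis
        using c[OF S(1), of x] c[OF S(2), of x] dist_triangle3[of "\<gamma> x" "\<gamma>' x" "c \<gamma> x"] by simp
    qed
    then show "\<gamma> = \<gamma>'" using near S \<open>S \<subseteq> \<Gamma>\<close> by blast
  qed
  moreover have "(\<lambda>\<gamma>. restrict (c \<gamma>) F) ` S \<subseteq> Pi\<^sub>E F Z"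
    using c by auto
  moreover have "finite (Pi\<^sub>E F Z)"
    using F(1) Z(1) by (intro finite_PiE)
  ultimately show ?thesis by (rule inj_on_finite)
qed

subsection \<open>Discrete groups acting on symmetric spaces\<close>

text \<open>Only finitely many elements move \<open>p\<close> by less than \<epsilon>, and trivial
  stabiliser makes each nontrivial displacement positive, so these displacements have a positive
  minimum. Left quotients extend the bound to all pairs.\<close>

lemma discrete_isometry_group_orbit_separated:
  fixes A :: "('a::metric_space, 'e::real_inner) chart set" and p :: 'a
  assumes X: "symmetric_space A G act" and \<Gamma>: "discrete_isometry_group \<Gamma>"
    and p: "isometry_stabilizer \<Gamma> p = {id}"
  shows "\<exists>r>0. \<forall>\<gamma>\<^sub>1\<in>\<Gamma>. \<forall>\<gamma>\<^sub>2\<in>\<Gamma>. \<gamma>\<^sub>1 \<noteq> \<gamma>\<^sub>2 \<longrightarrow> r \<le> dist (\<gamma>\<^sub>1 p) (\<gamma>\<^sub>2 p)"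
proof -
  have sub: "subgroup \<Gamma> isometry_group"
    using \<Gamma> unfolding discrete_isometry_group_def by blast
  have iso: "dist (\<gamma> x) (\<gamma> y) = dist x y" if "\<gamma> \<in> \<Gamma>" for \<gamma> x y
    using subgroup.subset[OF sub] that unfolding isometry_group_def by auto
  obtain \<epsilon> where \<epsilon>: "\<epsilon> > 0" "\<And>x::'a. \<exists>K. compact K \<and> ball x \<epsilon> \<subseteq> K"
    using symmetric_space_uniformly_locally_compact[OF X] by blast
  obtain L where L: "compact L" "ball p \<epsilon> \<subseteq> L"
    using \<epsilon>(2) by blast
  define S where "S = {\<gamma>\<in>\<Gamma>. dist p (\<gamma> p) < \<epsilon>}"
  have "finite S"
  proof (rule finite_isometries_relatively_compact_orbits[OF \<Gamma>])
    show "S \<subseteq> \<Gamma>" by (auto simp: S_def)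
    show "\<exists>K. compact K \<and> (\<forall>\<gamma>\<in>S. \<gamma> x \<in> K)" for x
      by (rule relatively_compact_orbits[OF symmetric_space_connected[OF X] \<epsilon> _ L(1)])
        (use L(2) iso in \<open>auto simp: S_def\<close>)
  qed
  \<comment> \<open>Inserting \<epsilon> keeps the set nonempty when \<open>S\<close> contains only
    the identity, and makes \<open>r\<close> a lower bound for displacements by elements outside
    \<open>S\<close> too.\<close>
  define r where "r = Min (insert \<epsilon> ((\<lambda>\<gamma>. dist p (\<gamma> p)) ` (S - {id})))"
  have moved: "\<gamma> p \<noteq> p" if "\<gamma> \<in> \<Gamma>" "\<gamma> \<noteq> id" for \<gamma>
    using p that by (auto simp: isometry_stabilizer_def stabilizer_def)
  have "r > 0"
    unfolding r_def using \<open>finite S\<close> \<epsilon>(1) moved by (force simp: S_def)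
  moreover have "r \<le> dist (\<gamma>\<^sub>1 p) (\<gamma>\<^sub>2 p)" if \<gamma>: "\<gamma>\<^sub>1 \<in> \<Gamma>" "\<gamma>\<^sub>2 \<in> \<Gamma>" "\<gamma>\<^sub>1 \<noteq> \<gamma>\<^sub>2" for \<gamma>\<^sub>1 \<gamma>\<^sub>2
  proof -
    obtain \<delta> where \<delta>: "\<delta> \<in> \<Gamma>" "\<gamma>\<^sub>2 = \<gamma>\<^sub>1 \<circ> \<delta>"
      using isometry_subgroup_left_quotient[OF sub \<gamma>(2,1)] by blast
    have "\<delta> \<noteq> id" using \<gamma>(3) \<delta>(2) by auto
    have "r \<le> dist p (\<delta> p)"
    proof (cases "\<delta> \<in> S")
      case True
      then show ?thesis
        unfolding r_def using \<open>finite S\<close> \<open>\<delta> \<noteq> id\<close> by (intro Min_le) auto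
    next
      case False
      have "r \<le> \<epsilon>" unfolding r_def using \<open>finite S\<close> by (intro Min_le) auto
      then show ?thesis using False \<delta>(1) by (simp add: S_def)
    qed
    then show ?thesis using iso[OF \<gamma>(1)] \<delta>(2) by simp
  qed
  ultimately show ?thesis by blast
qed

lemma geometric_dist_le:
  fixes p q :: "'a::metric_space"
  assumes iso: "\<And>\<gamma> x y. \<gamma> \<in> \<Gamma> \<Longrightarrow> dist (\<gamma> x) (\<gamma> y) = dist x y"
    and r: "r > 0" "\<And>\<gamma>\<^sub>1 \<gamma>\<^sub>2. \<gamma>\<^sub>1 \<in> \<Gamma> \<Longrightarrow> \<gamma>\<^sub>2 \<in> \<Gamma> \<Longrightarrow> \<gamma>\<^sub>1 \<noteq> \<gamma>\<^sub>2 \<Longrightarrow> r \<le> dist (\<gamma>\<^sub>1 p) (\<gamma>\<^sub>2 p)"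
    and \<gamma>: "\<gamma>\<^sub>1 \<in> \<Gamma>" "\<gamma>\<^sub>2 \<in> \<Gamma>"
  shows "geometric_dist q \<gamma>\<^sub>1 \<gamma>\<^sub>2 \<le> (1 + 2 * dist p q / r) * geometric_dist p \<gamma>\<^sub>1 \<gamma>\<^sub>2"
\<comment> \<open>For equal elements both sides vanish; the lower bound \<open>r\<close> speaks only
  of distinct ones.\<close>
proof (cases "\<gamma>\<^sub>1 = \<gamma>\<^sub>2")
  case True
  then show ?thesis by (simp add: geometric_dist_def)
next
  case False
  define D where "D = dist (\<gamma>\<^sub>1 p) (\<gamma>\<^sub>2 p)"
  have "dist (\<gamma>\<^sub>1 q) (\<gamma>\<^sub>2 q) \<le> dist (\<gamma>\<^sub>1 q) (\<gamma>\<^sub>1 p) + D + dist (\<gamma>\<^sub>2 p) (\<gamma>\<^sub>2 q)"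
    unfolding D_def using dist_triangle[of "\<gamma>\<^sub>1 q" "\<gamma>\<^sub>2 q" "\<gamma>\<^sub>1 p"] dist_triangle[of "\<gamma>\<^sub>1 p" "\<gamma>\<^sub>2 q" "\<gamma>\<^sub>2 p"]
    by linarith
  also have "\<dots> = 2 * dist p q + D"
    using iso \<gamma> by (simp add: dist_commute)
  also have "2 * dist p q = 2 * dist p q / r * r"
    using r(1) by simp
  \<comment> \<open>Since \<open>r \<le> D\<close>, the additive cost of changing the base point is
    absorbed into a multiple of \<open>D\<close>.\<close>
  also have "\<dots> \<le> 2 * dist p q / r * D"
    unfolding D_def using r \<gamma> False by (intro mult_left_mono) auto
  finally show ?thesis
    by (simp add: geometric_dist_def D_def algebra_simps)
qed

theorem lemma3p3p1:
  fixes A :: "('a::metric_space, 'e::real_inner) chart set"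
    and G :: "('g, 'm) monoid_scheme"
    and act :: "'g \<Rightarrow> 'a \<Rightarrow> 'a"
    and \<Gamma> :: "('a \<Rightarrow> 'a) set"
    and p q :: 'a
  assumes "symmetric_space A G act"
    and "discrete_isometry_group \<Gamma>"
    and "isometry_stabilizer \<Gamma> p = {id}"
    and "isometry_stabilizer \<Gamma> q = {id}"
  shows "lipschitz_equivalent \<Gamma> (geometric_dist p) (geometric_dist q)"
proof -
  have iso: "dist (\<gamma> x) (\<gamma> y) = dist x y" if "\<gamma> \<in> \<Gamma>" for \<gamma> x y
    using subgroup.subset that assms(2)
    unfolding discrete_isometry_group_def isometry_group_def by fastforce
  obtain r where r: "r > 0"
    "\<And>\<gamma>\<^sub>1 \<gamma>\<^sub>2. \<gamma>\<^sub>1 \<in> \<Gamma> \<Longrightarrow> \<gamma>\<^sub>2 \<in> \<Gamma> \<Longrightarrow> \<gamma>\<^sub>1 \<noteq> \<gamma>\<^sub>2 \<Longrightarrow> r \<le> dist (\<gamma>\<^sub>1 p) (\<gamma>\<^sub>2 p)"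
    using discrete_isometry_group_orbit_separated[OF assms(1-3)] by blast
  obtain s where s: "s > 0"
    "\<And>\<gamma>\<^sub>1 \<gamma>\<^sub>2. \<gamma>\<^sub>1 \<in> \<Gamma> \<Longrightarrow> \<gamma>\<^sub>2 \<in> \<Gamma> \<Longrightarrow> \<gamma>\<^sub>1 \<noteq> \<gamma>\<^sub>2 \<Longrightarrow> s \<le> dist (\<gamma>\<^sub>1 q) (\<gamma>\<^sub>2 q)"
    using discrete_isometry_group_orbit_separated[OF assms(1,2,4)] by blast
  define C where "C = 1 + 2 * dist p q / r"
  define C' where "C' = 1 + 2 * dist q p / s"
  have pos: "C > 0" "C' > 0"
    using r(1) s(1) by (auto simp: C_def C'_def intro!: add_pos_nonneg)
  have "geometric_dist q \<gamma>\<^sub>1 \<gamma>\<^sub>2 \<le> C * geometric_dist p \<gamma>\<^sub>1 \<gamma>\<^sub>2"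
    if "\<gamma>\<^sub>1 \<in> \<Gamma>" "\<gamma>\<^sub>2 \<in> \<Gamma>" for \<gamma>\<^sub>1 \<gamma>\<^sub>2
    unfolding C_def by (rule geometric_dist_le[where \<Gamma> = \<Gamma>]) (fact iso r that)+
  moreover have "geometric_dist p \<gamma>\<^sub>1 \<gamma>\<^sub>2 \<le> C' * geometric_dist q \<gamma>\<^sub>1 \<gamma>\<^sub>2"
    if "\<gamma>\<^sub>1 \<in> \<Gamma>" "\<gamma>\<^sub>2 \<in> \<Gamma>" for \<gamma>\<^sub>1 \<gamma>\<^sub>2
    unfolding C'_def by (rule geometric_dist_le[where \<Gamma> = \<Gamma>]) (fact iso s that)+
  \<comment> \<open>The estimate with \<open>p\<close> and \<open>q\<close> exchanged supplies the
    lower Lipschitz constant as the reciprocal of \<open>C'\<close>.\<close>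
  then have "1 / C' * geometric_dist p \<gamma>\<^sub>1 \<gamma>\<^sub>2 \<le> geometric_dist q \<gamma>\<^sub>1 \<gamma>\<^sub>2"
    if "\<gamma>\<^sub>1 \<in> \<Gamma>" "\<gamma>\<^sub>2 \<in> \<Gamma>" for \<gamma>\<^sub>1 \<gamma>\<^sub>2
    using that pos(2) by (simp add: pos_divide_le_eq mult.commute)
  ultimately show ?thesis
    unfolding lipschitz_equivalent_def using pos
    by (intro exI[of _ "1 / C'"] exI[of _ C]) auto
qed

end
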